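(* Let $n,m,d\in\mathbb{N}$, let $\Delta_{n-1}=\{\mathbf{x}\in\mathbb{R}^n_+:x_1+\dots+x_n=1\}$, let $f_0,f_1,\dots,f_m\in\mathbb{R}[\mathbf{x}]$ be homogeneous of degree $d$, let $b_1,\dots,b_m\in\mathbb{R}$, and assume the generalized moment problem \[ \mathrm{val}=\inf_{\mu\in\mathcal{M}(\Delta_{n-1})_+}\int_{\Delta_{n-1}} f_0\,\mathrm{d}\mu\quad\text{s.t.}\quad \int_{\Delta_{n-1}} f_i\,\mathrm{d}\mu=b_i\ (i\in[m]),\quad \int_{\Delta_{n-1}}\mathrm{d}\mu\le 1 \] is feasible. Assume its dual \[ \sup_{(y,t)\in\mathbb{R}^m\times\mathbb{R}_+}\ \sum_{i=1}^m y_ib_i-t\quad\text{s.t.}\quad f_0(\mathbf{x})-\sum_{i=1}^m y_if_i(\mathbf{x})+t\ge 0\ \ \forall\,\mathbf{x}\in \Delta_{n-1} \] has an optimal solution $(\bar y,t)$. Let $f_{m+1}:=1$ (the constant polynomial), $\bar y_{m+1}:=-t$, $y_0:=1$ and $y_i:=-\bar y_i$ for $i\in[m+1]$. Then for every integer $r>d(d-1)/2+1$, \[ 0\le \mathrm{val}-\underline{f}_{\mathrm{LP}}^{(r)}\le \frac{\Big(\sum_{i=0}^{m+1}B(y_if_i)+t\Big)\,d(d-1)}{2(r-1)-d(d-1)}, \] where $\underline{f}_{\mathrm{LP}}^{(r)}$ is the optimal value of the linear program \[ \underline{f}_{\mathrm{LP}}^{(r)}=\min\ L^{(r)}(f_0)\quad\text{s.t.}\quad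 L^{(r)}(f_i)=b_i\ (i\in[m]),\quad L^{(r)}(1)\le 1,\quad L^{(r)}(\mathbf{x}^\alpha)\ge 0\ (|\alpha|\le r),\quad L^{(r)}(\mathbf{x}^\alpha)=L^{(r)}\Big(\mathbf{x}^\alpha\sum_{i=1}^n x_i\Big)\ (|\alpha|\le r-1), \] over linear functionals $L^{(r)}:\mathbb{R}[\mathbf{x}]_r\to\mathbb{R}$.
   Context: $\mathcal{M}(\Delta_{n-1})_+$ is the cone of positive finite Borel measures supported on $\Delta_{n-1}$; $\mathbb{R}[\mathbf{x}]_r$ is the space of real polynomials in $n$ variables of degree at most $r$; $\mathbf{x}^\alpha=x_1^{\alpha_1}\cdots x_n^{\alpha_n}$, $|\alpha|=\sum_i\alpha_i$. For a homogeneous polynomial $f=\sum_{|\alpha|=e}f_\alpha\mathbf{x}^\alpha$ of degree $e$, $B(f)=\max_{|\alpha|=e}\frac{\alpha_1!\cdots\alpha_n!}{e!}f_\alpha$ (so for a constant $c$, $B(c)=c$). *)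

theory Defs
  imports "HOL-Analysis.Analysis"
begin

text \<open>Variables are indexed by a finite type 'n (so n = CARD('n)); points of R^n are real^'n.
  A monomial x^alpha is given by its exponent vector alpha :: 'n => nat.
  A (homogeneous) polynomial is given by its coefficient function on exponent vectors.\<close>

definition hmons :: "nat \<Rightarrow> ('n::finite \<Rightarrow> nat) set" where
  "hmons e = {\<alpha>. (\<Sum>i\<in>UNIV. \<alpha> i) = e}"

definition monom_eval :: "('n::finite \<Rightarrow> nat) \<Rightarrow> real^'n \<Rightarrow> real" where
  "monom_eval \<alpha> x = (\<Prod>i\<in>UNIV. (x$i) ^ (\<alpha> i))"

definition heval :: "nat \<Rightarrow> (('n::finite \<Rightarrow> nat) \<Rightarrow> real) \<Rightarrow> real^'n \<Rightarrow> real" where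
  "heval e f x = (\<Sum>\<alpha>\<in>hmons e. f \<alpha> * monom_eval \<alpha> x)"

definition is_homog :: "nat \<Rightarrow> (('n::finite \<Rightarrow> nat) \<Rightarrow> real) \<Rightarrow> bool" where
  "is_homog e f \<longleftrightarrow> (\<forall>\<alpha>. f \<alpha> \<noteq> 0 \<longrightarrow> \<alpha> \<in> hmons e)"

definition Bnum :: "nat \<Rightarrow> (('n::finite \<Rightarrow> nat) \<Rightarrow> real) \<Rightarrow> real" where
  "Bnum e f = Max ((\<lambda>\<alpha>. (\<Prod>i\<in>UNIV. fact (\<alpha> i)) / fact e * f \<alpha>) ` hmons e)"

definition std_simplex :: "(real^'n::finite) set" where
  "std_simplex = {x. (\<forall>i. 0 \<le> x$i) \<and> (\<Sum>i\<in>UNIV. x$i) = 1}"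

definition gmp_feasible ::
  "nat \<Rightarrow> nat \<Rightarrow> (nat \<Rightarrow> ('n::finite \<Rightarrow> nat) \<Rightarrow> real) \<Rightarrow> (nat \<Rightarrow> real) \<Rightarrow> (real^'n) measure \<Rightarrow> bool" where
  "gmp_feasible d m f b \<mu> \<longleftrightarrow>
     sets \<mu> = sets borel \<and> finite_measure \<mu> \<and> emeasure \<mu> (UNIV - std_simplex) = 0 \<and>
     (\<forall>i\<in>{1..m}. (LINT x:std_simplex|\<mu>. heval d (f i) x) = b i) \<and>
     measure \<mu> std_simplex \<le> 1"

definition gmp_val ::
  "nat \<Rightarrow> nat \<Rightarrow> (nat \<Rightarrow> ('n::finite \<Rightarrow> nat) \<Rightarrow> real) \<Rightarrow> (nat \<Rightarrow> real) \<Rightarrow> real" where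
  "gmp_val d m f b = Inf ((\<lambda>\<mu>. LINT x:std_simplex|\<mu>. heval d (f 0) x) ` {\<mu>. gmp_feasible d m f b \<mu>})"

definition dual_feasible ::
  "nat \<Rightarrow> nat \<Rightarrow> (nat \<Rightarrow> ('n::finite \<Rightarrow> nat) \<Rightarrow> real) \<Rightarrow> (nat \<Rightarrow> real) \<Rightarrow> real \<Rightarrow> bool" where
  "dual_feasible d m f y t \<longleftrightarrow> 0 \<le> t \<and>
     (\<forall>x\<in>(std_simplex :: (real^'n) set). heval d (f 0) x - (\<Sum>i\<in>{1..m}. y i * heval d (f i) x) + t \<ge> 0)"

definition dual_optimal ::
  "nat \<Rightarrow> nat \<Rightarrow> (nat \<Rightarrow> ('n::finite \<Rightarrow> nat) \<Rightarrow> real) \<Rightarrow> (nat \<Rightarrow> real) \<Rightarrow> (nat \<Rightarrow> real) \<Rightarrow> real \<Rightarrow> bool" where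
  "dual_optimal d m f b y t \<longleftrightarrow> dual_feasible d m f y t \<and>
     (\<forall>y' t'. dual_feasible d m f y' t' \<longrightarrow>
        (\<Sum>i\<in>{1..m}. y' i * b i) - t' \<le> (\<Sum>i\<in>{1..m}. y i * b i) - t)"

text \<open>A linear functional L on R[x]_r is determined by its values L(x^alpha), |alpha| <= r.
  (Values at higher-degree exponents are irrelevant.)  Its value on a homogeneous polynomial
  of degree e <= r:\<close>
definition Lapply :: "nat \<Rightarrow> (('n::finite \<Rightarrow> nat) \<Rightarrow> real) \<Rightarrow> (('n \<Rightarrow> nat) \<Rightarrow> real) \<Rightarrow> real" where
  "Lapply e L f = (\<Sum>\<alpha>\<in>hmons e. f \<alpha> * L \<alpha>)"

definition lp_feasible ::
  "nat \<Rightarrow> nat \<Rightarrow> (nat \<Rightarrow> ('n::finite \<Rightarrow> nat) \<Rightarrow> real) \<Rightarrow> (nat \<Rightarrow> real) \<Rightarrow> nat \<Rightarrow> (('n \<Rightarrow> nat) \<Rightarrow> real) \<Rightarrow> bool" where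
  "lp_feasible d m f b r L \<longleftrightarrow>
     (\<forall>i\<in>{1..m}. Lapply d L (f i) = b i) \<and>
     L (\<lambda>_. 0) \<le> 1 \<and>
     (\<forall>\<alpha>. (\<Sum>i\<in>UNIV. \<alpha> i) \<le> r \<longrightarrow> 0 \<le> L \<alpha>) \<and>
     (\<forall>\<alpha>. (\<Sum>i\<in>UNIV. \<alpha> i) \<le> r - 1 \<longrightarrow> L \<alpha> = (\<Sum>j\<in>UNIV. L (\<alpha>(j := \<alpha> j + 1))))"

definition lp_val ::
  "nat \<Rightarrow> nat \<Rightarrow> (nat \<Rightarrow> ('n::finite \<Rightarrow> nat) \<Rightarrow> real) \<Rightarrow> (nat \<Rightarrow> real) \<Rightarrow> nat \<Rightarrow> real" where
  "lp_val d m f b r = Inf ((\<lambda>L. Lapply d L (f 0)) ` {L. lp_feasible d m f b r L})"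

end

theory Submission
  imports Defs
begin

text \<open>Let p be the dual slack form f0 - sum ybar_i f_i + t (x1 + ... + xn)^d, which is nonnegative
  on the simplex. For L feasible in the linear program, L(p) = L(p (x1 + ... + xn)^(r-d)), and
  the Powers--Reznick estimate in Polya's theorem bounds the coefficients of that product below
  by -B(p) (r^d / (r (r-1) ... (r-d+1)) - 1) times the multinomial coefficients. Summing up,
  L(f0) is at least the dual value minus the claimed error, since L(1) \<le> 1. Conversely the
  moments of a feasible measure are feasible in the linear program, and there is no duality gap
  in the moment problem because the atomic measures with boundedly many atoms form a compact set
  with convex moment image (Caratheodory).\<close>

text \<open>The assumptions are a feasible measure and an attained dual, with no interior point, so
  the absence of a gap has to be derived from these. With \<open>v\<close> the dual optimum, either
  a feasible measure of cost at most \<open>v\<close> exists, or multipliers \<open>c\<close>,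
  \<open>c0\<close> certify that there is none. If \<open>c0 = 0\<close>, integrating the
  certificate against the given feasible measure refutes it; if \<open>c0 > 0\<close>, division by
  \<open>c0\<close> yields a dual point of value above \<open>v\<close>. In the estimate, B enters
  because coefficients are divided by multinomial coefficients: the multinomial theorem then
  evaluates the sum with powers, and Vandermonde's identity the sum with falling factorials. The
  constant d(d-1)/2 is the sum of the i < d in the factors 1 - i/r. No product of polynomials is
  formed: multiplication by x_j is the exponent shift \<open>inc j\<close>.\<close>

lemma finite_hmons: "finite (hmons e :: ('n::finite \<Rightarrow> nat) set)"
proof (rule finite_subset)
  show "(hmons e :: ('n \<Rightarrow> nat) set) \<subseteq> Pi\<^sub>E UNIV (\<lambda>_. {..e})"
    by (auto simp: hmons_def member_le_sum PiE_def Pi_def)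
qed (simp add: finite_PiE)

lemma hmons_0: "hmons 0 = {\<lambda>_::'n::finite. 0}"
  by (auto simp: hmons_def fun_eq_iff)

section \<open>Multinomial weights and the multinomial theorem\<close>

definition mfact :: "('n::finite \<Rightarrow> nat) \<Rightarrow> real" where
  "mfact \<alpha> = (\<Prod>i\<in>UNIV. fact (\<alpha> i))"

text \<open>The image of (x1 + ... + xn)^e under the linear map that sends x^\<alpha> to
  \<open>g \<alpha>\<close>. An arbitrary \<open>g\<close> covers monomials, falling factorials and
  functionals alike.\<close>

definition multi_sum :: "nat \<Rightarrow> (('n::finite \<Rightarrow> nat) \<Rightarrow> real) \<Rightarrow> real" where
  "multi_sum e g = (\<Sum>\<alpha>\<in>hmons e. fact e / mfact \<alpha> * g \<alpha>)"

definition inc :: "'n \<Rightarrow> ('n::finite \<Rightarrow> nat) \<Rightarrow> 'n \<Rightarrow> nat" where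
  "inc j \<alpha> = \<alpha>(j := \<alpha> j + 1)"

lemma mfact_pos: "mfact \<alpha> > 0"
  by (simp add: mfact_def prod_pos)

lemma mfact_nonneg [simp]: "0 \<le> mfact \<alpha>"
  using mfact_pos[of \<alpha>] by simp

lemma mfact_nonzero [simp]: "mfact \<alpha> \<noteq> 0"
  using mfact_pos[of \<alpha>] by simp

lemma prod_inc: 
  fixes \<alpha> :: "'n::finite \<Rightarrow> nat"
  shows "(\<Prod>i\<in>UNIV. h i (inc j \<alpha> i)) = h j (\<alpha> j + 1) * (\<Prod>i\<in>UNIV-{j}. h i (\<alpha> i) :: 'a::comm_monoid_mult)"
  by (subst prod.remove[of _ j]) (auto simp: inc_def intro!: prod.cong)

lemma prod_split_coordinate: 
  fixes \<alpha> :: "'n::finite \<Rightarrow> nat"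
  shows "(\<Prod>i\<in>UNIV. h i (\<alpha> i)) = h j (\<alpha> j) * (\<Prod>i\<in>UNIV-{j}. h i (\<alpha> i) :: 'a::comm_monoid_mult)"
  by (subst prod.remove[of _ j]) auto

lemma sum_inc:
  fixes \<alpha> :: "'n::finite \<Rightarrow> nat"
  shows "(\<Sum>i\<in>UNIV. inc j \<alpha> i) = Suc (\<Sum>i\<in>UNIV. \<alpha> i)"
  by (subst (1 2) sum.remove[of _ j]) (auto simp: inc_def intro!: sum.cong)

lemma mfact_inc: "mfact (inc j \<alpha>) = real (\<alpha> j + 1) * mfact \<alpha>"
  unfolding mfact_def by (subst prod_inc, subst prod_split_coordinate[of _ _ j]) (simp add: algebra_simps)

lemma bij_betw_inc:
  "bij_betw (inc j) (hmons e) {\<alpha>\<in>hmons (Suc e). \<alpha> j > 0}"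
proof (rule bij_betw_byWitness[where f' = "\<lambda>\<alpha>. \<alpha>(j := \<alpha> j - 1)"])
  have "\<alpha> \<in> hmons (Suc e) \<Longrightarrow> \<alpha> j > 0 \<Longrightarrow> \<alpha>(j := \<alpha> j - 1) \<in> hmons e" for \<alpha> :: "'a \<Rightarrow> nat"
    using sum_inc[of j "\<alpha>(j := \<alpha> j - 1)"] by (auto simp: hmons_def inc_def)
  then show "(\<lambda>\<alpha>. \<alpha>(j := \<alpha> j - 1)) ` {\<alpha> \<in> hmons (Suc e). 0 < \<alpha> j} \<subseteq> hmons e"
    by blast
  show "inc j ` hmons e \<subseteq> {\<alpha> \<in> hmons (Suc e). 0 < \<alpha> j}"
    using sum_inc by (auto simp: hmons_def) (simp add: inc_def)
qed (auto simp: inc_def)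

text \<open>Pascal's rule for multinomial coefficients.\<close>

lemma multi_sum_Suc:
  "multi_sum (Suc e) g = (\<Sum>j\<in>UNIV. multi_sum e (\<lambda>\<alpha>. g (inc j \<alpha>)))"
proof -
  \<comment> \<open>The factor \<open>\<alpha> j\<close> comes from \<open>mfact_inc\<close> and
    vanishes at the exponents missed by \<open>inc j\<close>, so the sum extends to all of
    \<open>hmons (Suc e)\<close>; over all j these factors add up to \<open>Suc e\<close>.\<close>
  have *: "multi_sum e (\<lambda>\<alpha>. g (inc j \<alpha>)) = (\<Sum>\<alpha>\<in>hmons (Suc e). real (\<alpha> j) * (fact e / mfact \<alpha> * g \<alpha>))" for j
  proof -
    have "multi_sum e (\<lambda>\<alpha>. g (inc j \<alpha>))
        = (\<Sum>\<alpha>\<in>hmons e. real (inc j \<alpha> j) * (fact e / mfact (inc j \<alpha>) * g (inc j \<alpha>)))"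
      unfolding multi_sum_def
    proof (intro sum.cong refl)
      fix \<alpha> :: "'a \<Rightarrow> nat"
      have "mfact (inc j \<alpha>) = real (inc j \<alpha> j) * mfact \<alpha>" "real (inc j \<alpha> j) \<noteq> 0"
        by (simp_all add: mfact_inc) (simp_all add: inc_def)
      then show "fact e / mfact \<alpha> * g (inc j \<alpha>)
          = real (inc j \<alpha> j) * (fact e / mfact (inc j \<alpha>) * g (inc j \<alpha>))"
        by simp
    qed
    also have "\<dots> = (\<Sum>\<alpha>\<in>{\<alpha>\<in>hmons (Suc e). \<alpha> j > 0}. real (\<alpha> j) * (fact e / mfact \<alpha> * g \<alpha>))"
      by (rule sum.reindex_bij_betw[OF bij_betw_inc])
    also have "\<dots> = (\<Sum>\<alpha>\<in>hmons (Suc e). real (\<alpha> j) * (fact e / mfact \<alpha> * g \<alpha>))"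
      by (intro sum.mono_neutral_left) (auto simp: finite_hmons)
    finally show ?thesis .
  qed
  have "(\<Sum>j\<in>UNIV. multi_sum e (\<lambda>\<alpha>. g (inc j \<alpha>)))
      = (\<Sum>\<alpha>\<in>hmons (Suc e). (\<Sum>j\<in>UNIV. real (\<alpha> j)) * (fact e / mfact \<alpha> * g \<alpha>))"
    unfolding * sum_distrib_right by (rule sum.swap)
  also have "\<dots> = multi_sum (Suc e) g"
    unfolding multi_sum_def
  proof (intro sum.cong refl)
    fix \<alpha> :: "'a \<Rightarrow> nat" assume "\<alpha> \<in> hmons (Suc e)"
    then have "(\<Sum>j\<in>UNIV. real (\<alpha> j)) = real (Suc e)"
      by (metis (mono_tags) hmons_def mem_Collect_eq of_nat_sum)
    then show "(\<Sum>j\<in>UNIV. real (\<alpha> j)) * (fact e / mfact \<alpha> * g \<alpha>) = fact (Suc e) / mfact \<alpha> * g \<alpha>"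
      by simp
  qed
  finally show ?thesis by simp
qed

lemma multi_sum_0: "multi_sum 0 g = g (\<lambda>_. 0)"
  by (simp add: multi_sum_def hmons_0 mfact_def)

lemma multi_sum_mult: "multi_sum e (\<lambda>\<alpha>. c * g \<alpha>) = c * multi_sum e g"
  by (simp add: multi_sum_def sum_distrib_left mult_ac)

lemma multi_sum_cong: "(\<And>\<alpha>. \<alpha> \<in> hmons e \<Longrightarrow> g \<alpha> = h \<alpha>) \<Longrightarrow> multi_sum e g = multi_sum e h"
  by (simp add: multi_sum_def)

lemma multi_sum_monom: "multi_sum e (\<lambda>\<alpha>. monom_eval \<alpha> x) = (\<Sum>i\<in>UNIV. x $ i) ^ e"
proof (induction e)
  case (Suc e)
  have "monom_eval (inc j \<alpha>) x = x $ j * monom_eval \<alpha> x" for j \<alpha>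
    unfolding monom_eval_def by (subst prod_inc, subst prod_split_coordinate[of _ _ j]) simp
  then show ?case by (simp add: multi_sum_Suc multi_sum_mult Suc sum_distrib_right)
qed (simp add: multi_sum_0 monom_eval_def)

section \<open>Falling factorials and the expansion of L at level r\<close>

definition ffact :: "nat \<Rightarrow> nat \<Rightarrow> real" where
  "ffact b k = (\<Prod>i<k. real b - real i)"

lemma ffact_Suc: "ffact b (Suc k) = ffact b k * (real b - real k)"
  by (simp add: ffact_def)

lemma ffact_eq_0: "b < k \<Longrightarrow> ffact b k = 0"
  by (auto simp: ffact_def intro!: prod_zero)

lemma fact_eq_ffact: "k \<le> b \<Longrightarrow> fact b = fact (b - k) * ffact b k"
proof (induction k)
  case (Suc k)
  then have "fact (b - k) = (real b - real k) * fact (b - Suc k)"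
    by (subst fact_reduce) (auto simp: of_nat_diff)
  with Suc show ?case by (simp add: ffact_Suc)
qed (simp add: ffact_def)

lemma ffact_nonneg: "ffact b k \<ge> 0"
  by (cases "b < k") (auto simp: ffact_eq_0, auto simp: ffact_def intro!: prod_nonneg)

lemma ffact_le_power: "ffact b k \<le> real b ^ k"
proof (cases "b < k")
  case False
  then have "ffact b k \<le> (\<Prod>i<k. real b)"
    unfolding ffact_def by (intro prod_mono) auto
  then show ?thesis by simp
qed (simp add: ffact_eq_0)

text \<open>Equal to \<beta>!/(\<beta> - \<alpha>)! if \<alpha> \<le> \<beta> in every coordinate
  and zero otherwise.\<close>

definition mffact :: "('n::finite \<Rightarrow> nat) \<Rightarrow> ('n \<Rightarrow> nat) \<Rightarrow> real" where
  "mffact \<beta> \<alpha> = (\<Prod>i\<in>UNIV. ffact (\<beta> i) (\<alpha> i))"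

text \<open>Vandermonde's identity in several variables. In the induction \<open>inc j\<close>
  contributes the factor \<beta>_j - \<alpha>_j, and for |\<alpha>| = e these add up to |\<beta>| -
  e.\<close>

lemma multi_sum_mffact_vandermonde: "multi_sum e (mffact \<beta>) = ffact (\<Sum>i\<in>UNIV. \<beta> i) e"
proof (induction e)
  case (Suc e)
  have inc: "mffact \<beta> (inc j \<alpha>) = (real (\<beta> j) - real (\<alpha> j)) * mffact \<beta> \<alpha>" for j \<alpha>
    unfolding mffact_def by (subst prod_inc, subst prod_split_coordinate[of _ _ j]) (simp add: ffact_Suc)
  have "multi_sum (Suc e) (mffact \<beta>) = multi_sum e (\<lambda>\<alpha>. \<Sum>j\<in>UNIV. (real (\<beta> j) - real (\<alpha> j)) * mffact \<beta> \<alpha>)"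
    unfolding multi_sum_Suc inc by (simp add: multi_sum_def sum_distrib_left sum.swap[of _ UNIV])
  also have "\<dots> = multi_sum e (\<lambda>\<alpha>. (real (\<Sum>i\<in>UNIV. \<beta> i) - real e) * mffact \<beta> \<alpha>)"
  proof (rule multi_sum_cong)
    fix \<alpha> :: "'a \<Rightarrow> nat" assume "\<alpha> \<in> hmons e"
    then have "real (\<Sum>i\<in>UNIV. \<alpha> i) = real e" by (simp add: hmons_def)
    then show "(\<Sum>j\<in>UNIV. (real (\<beta> j) - real (\<alpha> j)) * mffact \<beta> \<alpha>)
      = (real (\<Sum>i\<in>UNIV. \<beta> i) - real e) * mffact \<beta> \<alpha>"
      by (simp add: sum_distrib_right[symmetric] sum_subtractf)
  qed
  finally show ?case by (simp add: multi_sum_mult Suc ffact_Suc)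
qed (simp add: multi_sum_0 mffact_def ffact_def)

text \<open>Iterates the constraint of the linear program: L(x^\<alpha> (x1 + ... + xn)^e) =
  L(x^\<alpha>). The bound on the total degree keeps each use of the constraint at degree at most r
  - 1.\<close>

lemma multi_sum_consistent:
  fixes L :: "('n::finite \<Rightarrow> nat) \<Rightarrow> real"
  assumes L: "\<And>\<alpha>. (\<Sum>i\<in>UNIV. \<alpha> i) \<le> r - 1 \<Longrightarrow> L \<alpha> = (\<Sum>j\<in>UNIV. L (inc j \<alpha>))"
    and "(\<Sum>i\<in>UNIV. \<alpha> i) + e \<le> r"
  shows "multi_sum e (\<lambda>\<gamma>. L (\<lambda>i. \<alpha> i + \<gamma> i)) = L \<alpha>"
  using assms(2)
proof (induction e arbitrary: \<alpha>)
  case (Suc e)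
  have "multi_sum e (\<lambda>\<gamma>. L (\<lambda>i. \<alpha> i + inc j \<gamma> i)) = L (inc j \<alpha>)" for j
  proof -
    have "(\<lambda>i. \<alpha> i + inc j \<gamma> i) = (\<lambda>i. inc j \<alpha> i + \<gamma> i)" for \<gamma>
      by (auto simp: inc_def)
    then show ?thesis
      using Suc.IH[of "inc j \<alpha>"] Suc.prems by (simp add: sum_inc)
  qed
  then show ?case
    using L[of \<alpha>] Suc.prems by (simp add: multi_sum_Suc)
qed (simp add: multi_sum_0)

text \<open>This evaluates L on x^alpha (x1 + ... + xn)^(r-d).\<close>

lemma consistent_expand:
  fixes L :: "('n::finite \<Rightarrow> nat) \<Rightarrow> real"
  assumes L: "\<And>\<alpha>. (\<Sum>i\<in>UNIV. \<alpha> i) \<le> r - 1 \<Longrightarrow> L \<alpha> = (\<Sum>j\<in>UNIV. L (inc j \<alpha>))"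
    and \<alpha>: "\<alpha> \<in> hmons d" and "d \<le> r"
  shows "L \<alpha> = (\<Sum>\<beta>\<in>hmons r. fact (r - d) / mfact \<beta> * L \<beta> * mffact \<beta> \<alpha>)"
proof -
  let ?S = "{\<beta>\<in>hmons r. \<forall>i. \<alpha> i \<le> \<beta> i}"
  have \<alpha>d: "(\<Sum>i\<in>UNIV. \<alpha> i) = d" using \<alpha> by (simp add: hmons_def)
  have bij: "bij_betw (\<lambda>\<gamma> i. \<alpha> i + \<gamma> i) (hmons (r - d)) ?S"
    by (rule bij_betw_byWitness[where f' = "\<lambda>\<beta> i. \<beta> i - \<alpha> i"])
      (use \<alpha>d \<open>d \<le> r\<close> in \<open>auto simp: hmons_def fun_eq_iff sum.distrib sum_subtractf_nat\<close>)
  have "L \<alpha> = multi_sum (r - d) (\<lambda>\<gamma>. L (\<lambda>i. \<alpha> i + \<gamma> i))"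
    using multi_sum_consistent[of r L \<alpha> "r - d"] L \<alpha>d \<open>d \<le> r\<close> by simp
  also have "\<dots> = (\<Sum>\<gamma>\<in>hmons (r - d). fact (r - d) / mfact (\<lambda>i. (\<alpha> i + \<gamma> i) - \<alpha> i) * L (\<lambda>i. \<alpha> i + \<gamma> i))"
    by (simp add: multi_sum_def)
  also have "\<dots> = (\<Sum>\<beta>\<in>?S. fact (r - d) / mfact (\<lambda>i. \<beta> i - \<alpha> i) * L \<beta>)"
    by (rule sum.reindex_bij_betw[OF bij, of "\<lambda>\<beta>. fact (r - d) / mfact (\<lambda>i. \<beta> i - \<alpha> i) * L \<beta>"])
  also have "\<dots> = (\<Sum>\<beta>\<in>?S. fact (r - d) / mfact \<beta> * L \<beta> * mffact \<beta> \<alpha>)"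
  proof (intro sum.cong refl)
    fix \<beta> assume "\<beta> \<in> ?S"
    then have "mfact \<beta> = mfact (\<lambda>i. \<beta> i - \<alpha> i) * mffact \<beta> \<alpha>"
      unfolding mfact_def mffact_def prod.distrib[symmetric]
      by (intro prod.cong refl fact_eq_ffact) auto
    then show "fact (r - d) / mfact (\<lambda>i. \<beta> i - \<alpha> i) * L \<beta> = fact (r - d) / mfact \<beta> * L \<beta> * mffact \<beta> \<alpha>"
      using mfact_pos[of \<beta>] by (auto simp: field_simps)
  qed
  \<comment> \<open>The index set becomes independent of \<alpha>, so that the sums over \<alpha>
    and \<beta> can be exchanged later.\<close>
  also have "\<dots> = (\<Sum>\<beta>\<in>hmons r. fact (r - d) / mfact \<beta> * L \<beta> * mffact \<beta> \<alpha>)"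
  proof (intro sum.mono_neutral_left ballI)
    fix \<beta> assume "\<beta> \<in> hmons r - ?S"
    then obtain i where "\<beta> i < \<alpha> i" by (auto simp: not_le)
    then have "mffact \<beta> \<alpha> = 0"
      unfolding mffact_def by (intro prod_zero bexI[of _ i]) (auto simp: ffact_eq_0)
    then show "fact (r - d) / mfact \<beta> * L \<beta> * mffact \<beta> \<alpha> = 0" by simp
  qed (auto simp: finite_hmons)
  finally show ?thesis .
qed

section \<open>The Powers--Reznick estimate and its constant\<close>

lemma mffact_le_monom: "mffact \<beta> \<alpha> \<le> monom_eval \<alpha> (\<chi> i. real (\<beta> i))"
  unfolding mffact_def monom_eval_def by (auto intro!: prod_mono simp: ffact_nonneg ffact_le_power)

lemma Bnum_ge: "\<alpha> \<in> hmons e \<Longrightarrow> mfact \<alpha> / fact e * f \<alpha> \<le> Bnum e f"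
  unfolding Bnum_def mfact_def by (intro Max_ge) (auto simp: finite_hmons)

lemma heval_as_multi_sum: "heval e f x = multi_sum e (\<lambda>\<alpha>. mfact \<alpha> / fact e * f \<alpha> * monom_eval \<alpha> x)"
  by (simp add: heval_def multi_sum_def)

lemma multi_sum_mono: "(\<And>\<alpha>. \<alpha> \<in> hmons e \<Longrightarrow> g \<alpha> \<le> h \<alpha>) \<Longrightarrow> multi_sum e g \<le> multi_sum e h"
  unfolding multi_sum_def by (intro sum_mono mult_left_mono) auto

lemma monom_eval_scale: "\<alpha> \<in> hmons e \<Longrightarrow> monom_eval \<alpha> (c *\<^sub>R x) = c ^ e * monom_eval \<alpha> x"
  by (simp add: monom_eval_def hmons_def power_mult_distrib prod.distrib power_sum[symmetric])

lemma heval_scale: "heval e f (c *\<^sub>R x) = c ^ e * heval e f x"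
  by (simp add: heval_def sum_distrib_left monom_eval_scale mult_ac)

lemma std_simplex_axis: "axis i 1 \<in> std_simplex"
  by (auto simp: std_simplex_def axis_def)

lemma monom_eval_nonneg: "x \<in> std_simplex \<Longrightarrow> monom_eval \<alpha> x \<ge> 0"
  by (auto simp: monom_eval_def std_simplex_def intro!: prod_nonneg)

text \<open>On the simplex the value of a form is a convex combination of its normalised
  coefficients, hence at most their maximum; a vertex supplies a point.\<close>

lemma Bnum_nonneg:
  fixes p :: "('n::finite \<Rightarrow> nat) \<Rightarrow> real"
  assumes "\<And>x. x \<in> std_simplex \<Longrightarrow> 0 \<le> heval e p x"
  shows "0 \<le> Bnum e p"
proof -
  define x :: "real^'n" where "x = axis undefined 1"
  have x: "x \<in> std_simplex" by (simp add: x_def std_simplex_axis)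
  have "heval e p x \<le> multi_sum e (\<lambda>\<alpha>. Bnum e p * monom_eval \<alpha> x)"
    unfolding heval_as_multi_sum
    by (intro multi_sum_mono mult_right_mono Bnum_ge monom_eval_nonneg x)
  also have "\<dots> = Bnum e p"
    using x by (simp add: multi_sum_mult multi_sum_monom std_simplex_def)
  finally show ?thesis using assms[OF x] by simp
qed

text \<open>The Powers--Reznick estimate: the coefficients of p (x1 + ... + xn)^(r-d) are, up to
  positive factors, the sums on the left, where the falling factorials replace the powers in
  the value of p at a lattice point.\<close>

lemma polya_coefficient_bound:
  fixes p :: "('n::finite \<Rightarrow> nat) \<Rightarrow> real"
  assumes p: "\<And>x. x \<in> std_simplex \<Longrightarrow> 0 \<le> heval d p x"
    and \<beta>: "\<beta> \<in> hmons r"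
  shows "(\<Sum>\<alpha>\<in>hmons d. p \<alpha> * mffact \<beta> \<alpha>) \<ge> - Bnum d p * (real r ^ d - ffact r d)"
proof -
  define x :: "real^'n" where "x = (\<chi> i. real (\<beta> i))"
  have sx: "(\<Sum>i\<in>UNIV. x $ i) = real r"
    using \<beta> unfolding x_def hmons_def by (simp flip: of_nat_sum)
  have nonneg: "heval d p x \<ge> 0"
  proof (cases "r = 0")
    case False
    then have "(1 / real r) *\<^sub>R x \<in> std_simplex"
      using sx unfolding std_simplex_def by (simp add: sum_divide_distrib[symmetric]) (simp add: x_def)
    then have "0 \<le> heval d p (real r *\<^sub>R (1 / real r) *\<^sub>R x)"
      using p by (simp only: heval_scale[of d p "real r"]) simp
    then show ?thesis using False by simp
  next
    \<comment> \<open>There is no point \<beta>/r here; x is 0 times a vertex, and scaling still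
      applies, with 0^0 = 1 when d = 0.\<close>
    case True
    then have "\<beta> = (\<lambda>_. 0)" using \<beta> by (simp add: hmons_0)
    then have "x = 0 *\<^sub>R axis undefined 1" by (simp add: x_def vec_eq_iff)
    then show ?thesis
      using p[OF std_simplex_axis] by (simp only: heval_scale) simp
  qed
  have "heval d p x - (\<Sum>\<alpha>\<in>hmons d. p \<alpha> * mffact \<beta> \<alpha>)
      = multi_sum d (\<lambda>\<alpha>. mfact \<alpha> / fact d * p \<alpha> * (monom_eval \<alpha> x - mffact \<beta> \<alpha>))"
    unfolding heval_def multi_sum_def sum_subtractf[symmetric]
    by (intro sum.cong refl) (simp add: right_diff_distrib)
  \<comment> \<open>Powers dominate falling factorials, so the differences are nonnegative and each
    normalised coefficient may be replaced by B(p).\<close>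
  also have "\<dots> \<le> multi_sum d (\<lambda>\<alpha>. Bnum d p * (monom_eval \<alpha> x - mffact \<beta> \<alpha>))"
    by (intro multi_sum_mono mult_right_mono Bnum_ge) (auto simp: x_def mffact_le_monom)
  also have "\<dots> = Bnum d p * (multi_sum d (\<lambda>\<alpha>. monom_eval \<alpha> x) - multi_sum d (mffact \<beta>))"
    by (simp only: multi_sum_mult) (simp add: multi_sum_def right_diff_distrib sum_subtractf)
  also have "\<dots> = Bnum d p * (real r ^ d - ffact r d)"
    using \<beta> by (simp add: multi_sum_monom multi_sum_mffact_vandermonde sx hmons_def)
  finally show ?thesis using nonneg by (simp add: algebra_simps)
qed

text \<open>Weierstrass' inequality: the product of the 1 - i/r over i < d is at least 1 minus the
  sum of the i/r.\<close>

lemma ffact_lower: "r > 0 \<Longrightarrow> d \<le> r \<Longrightarrow> ffact r d \<ge> real r ^ d * (1 - real d * (real d - 1) / (2 * real r))"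
proof (induction d)
  case (Suc d)
  have "(1 - real d * (real d - 1) / (2 * real r)) * (1 - real d / real r) \<ge> 
     1 - real (Suc d) * (real (Suc d) - 1) / (2 * real r)"
  proof -
    have "(real d * (real d - 1) / (2 * real r)) * (real d / real r) \<ge> 0"
      by (cases d) auto
    then have "(1 - real d * (real d - 1) / (2 * real r)) * (1 - real d / real r)
        \<ge> 1 - (real d * (real d - 1) / (2 * real r) + real d / real r)"
      unfolding left_diff_distrib right_diff_distrib by linarith
    moreover have "real (Suc d) * (real (Suc d) - 1) / (2 * real r) = real d * (real d - 1) / (2 * real r) + real d / real r"
      using Suc.prems by (simp add: field_simps)
    ultimately show ?thesis by simp
  qed
  then have "real r ^ Suc d * (1 - real (Suc d) * (real (Suc d) - 1) / (2 * real r))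
    \<le> real r ^ Suc d * ((1 - real d * (real d - 1) / (2 * real r)) * (1 - real d / real r))"
    by (intro mult_left_mono) auto
  also have "\<dots> = (real r ^ d * (1 - real d * (real d - 1) / (2 * real r))) * (real r - real d)"
    using Suc.prems by (simp add: field_simps)
  also have "\<dots> \<le> ffact r (Suc d)"
    unfolding ffact_Suc using Suc by (intro mult_right_mono) auto
  finally show ?case .
qed (simp add: ffact_def)

lemma ffact_ratio:
  assumes r: "real r > real d * (real d - 1) / 2 + 1" and d: "d \<le> r"
  shows "ffact r d > 0"
    and "(real r ^ d - ffact r d) / ffact r d \<le> real d * (real d - 1) / (2 * (real r - 1) - real d * (real d - 1))"
proof -
  define D where "D = real d * (real d - 1)"
  have D: "D \<ge> 0" unfolding D_def by (cases d) auto
  have r': "2 * real r - 2 > D" using r by (simp add: D_def)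
  have r0: "real r > 0" using r' D by simp
  define q where "q = 1 - D / (2 * real r)"
  have q: "q > 0" using r' r0 by (simp add: q_def)
  have low: "ffact r d \<ge> real r ^ d * q"
    using ffact_lower[of r d] r0 d by (simp add: q_def D_def)
  have pos: "real r ^ d * q > 0" using q r0 by simp
  show F: "ffact r d > 0" using low pos by linarith
  have "(real r ^ d - ffact r d) / ffact r d = real r ^ d / ffact r d - 1"
    using F by (simp add: field_simps)
  also have "\<dots> \<le> real r ^ d / (real r ^ d * q) - 1"
    using low pos r0 F by (intro diff_right_mono divide_left_mono) auto
  also have "\<dots> = 1 / q - 1" using r0 by simp
  also have "\<dots> = D / (2 * real r - D)"
    using q r0 r' D by (simp add: q_def field_simps)
  \<comment> \<open>Passing from r to r - 1 gives the denominator of the claim, whose positivity is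
    exactly the hypothesis on r.\<close>
  also have "\<dots> \<le> D / (2 * (real r - 1) - D)"
    using D r' by (intro divide_left_mono) auto
  finally show "(real r ^ d - ffact r d) / ffact r d \<le> real d * (real d - 1) / (2 * (real r - 1) - real d * (real d - 1))"
    by (simp add: D_def)
qed

text \<open>Rests on (d-1)(d-2) being nonnegative for integers. It puts the forms of degree d within
  the range where \<open>L\<close> is constrained.\<close>

lemma degree_le_level:
  assumes r: "real r > real d * (real d - 1) / 2 + 1"
  shows "d \<le> r"
proof -
  have "(real d - 1) * (real d - 2) \<ge> 0"
  proof (cases "d \<ge> 2")
    case False
    then have "d = 0 \<or> d = 1" by auto
    then show ?thesis by auto
  qed auto
  then have "real d \<le> real d * (real d - 1) / 2 + 1" by (simp add: field_simps)
  then show ?thesis using r by linarith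
qed

text \<open>Expanded at level r, \<open>L\<close> puts nonnegative weights on the Polya
  coefficients, with total L(1) / \<open>ffact r d\<close> because the multinomial sum of
  \<open>L\<close> over degree r is L(1).\<close>

lemma Lapply_lower_bound:
  fixes p L :: "('n::finite \<Rightarrow> nat) \<Rightarrow> real"
  assumes r: "real r > real d * (real d - 1) / 2 + 1"
    and p: "\<And>x. x \<in> std_simplex \<Longrightarrow> 0 \<le> heval d p x"
    and nonneg: "\<And>\<alpha>. (\<Sum>i\<in>UNIV. \<alpha> i) \<le> r \<Longrightarrow> 0 \<le> L \<alpha>"
    and L: "\<And>\<alpha>. (\<Sum>i\<in>UNIV. \<alpha> i) \<le> r - 1 \<Longrightarrow> L \<alpha> = (\<Sum>j\<in>UNIV. L (inc j \<alpha>))"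
    and L1: "L (\<lambda>_. 0) \<le> 1"
  shows "Lapply d L p \<ge> - (Bnum d p * (real d * (real d - 1) / (2 * (real r - 1) - real d * (real d - 1))))"
proof -
  let ?D = "real d * (real d - 1) / (2 * (real r - 1) - real d * (real d - 1))"
  have d: "d \<le> r" using degree_le_level[OF r] .
  have B: "Bnum d p \<ge> 0" using Bnum_nonneg[OF p] .
  have F: "ffact r d > 0" using ffact_ratio(1)[OF r d] .
  define Q where "Q = (real r ^ d - ffact r d) / ffact r d"
  have Q0: "Q \<ge> 0" using F ffact_le_power[of r d] by (simp add: Q_def)
  have fr: "fact r = fact (r - d) * ffact r d" using fact_eq_ffact[OF d] by simp
  have w: "fact (r - d) / mfact \<beta> * L \<beta> \<ge> 0" if "\<beta> \<in> hmons r" for \<beta>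
    using that mfact_pos[of \<beta>] nonneg[of \<beta>] by (simp add: hmons_def)
  have "Lapply d L p = (\<Sum>\<alpha>\<in>hmons d. \<Sum>\<beta>\<in>hmons r. p \<alpha> * (fact (r - d) / mfact \<beta> * L \<beta> * mffact \<beta> \<alpha>))"
    unfolding Lapply_def sum_distrib_left[symmetric]
    by (intro sum.cong refl arg_cong2[where f = "(*)"] consistent_expand[OF L _ d]) auto
  also have "\<dots> = (\<Sum>\<beta>\<in>hmons r. fact (r - d) / mfact \<beta> * L \<beta> * (\<Sum>\<alpha>\<in>hmons d. p \<alpha> * mffact \<beta> \<alpha>))"
    unfolding sum_distrib_left by (subst sum.swap) (intro sum.cong refl, simp add: mult_ac)
  also have "\<dots> \<ge> (\<Sum>\<beta>\<in>hmons r. fact (r - d) / mfact \<beta> * L \<beta> * (- Bnum d p * (real r ^ d - ffact r d)))"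
    by (intro sum_mono mult_left_mono polya_coefficient_bound p w) auto
  also have "(\<Sum>\<beta>\<in>hmons r. fact (r - d) / mfact \<beta> * L \<beta> * (- Bnum d p * (real r ^ d - ffact r d)))
     = - Bnum d p * Q * multi_sum r L"
    unfolding multi_sum_def sum_distrib_left fr Q_def using F
    by (intro sum.cong refl) (simp add: field_simps)
  also have "multi_sum r L = L (\<lambda>_. 0)"
    using multi_sum_consistent[of r L "\<lambda>_. 0" r] L by simp
  finally have "Lapply d L p \<ge> - (Bnum d p * Q * L (\<lambda>_. 0))" by simp
  moreover have "Bnum d p * Q * L (\<lambda>_. 0) \<le> Bnum d p * Q"
    using L1 B Q0 by (intro mult_left_le) auto
  moreover have "Bnum d p * Q \<le> Bnum d p * ?D"
    using ffact_ratio(2)[OF r d] B unfolding Q_def by (rule mult_left_mono)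
  ultimately show ?thesis by linarith
qed

section \<open>Caratheodory reduction of weights\<close>

text \<open>Gaussian elimination: equation \<open>k\<close> is solved for the unknown at a pivot
  \<open>j0\<close> (the value \<open>s\<close>) and substituted into the others.\<close>

lemma homogeneous_system_nontrivial:
  fixes a :: "nat \<Rightarrow> 'j \<Rightarrow> real"
  assumes "finite J" "k < card J"
  shows "\<exists>u. (\<exists>j\<in>J. u j \<noteq> 0) \<and> (\<forall>i<k. (\<Sum>j\<in>J. a i j * u j) = 0)"
  using assms
proof (induction k arbitrary: a J)
  case 0
  then obtain j where "j \<in> J" by fastforce
  then show ?case by (intro exI[of _ "\<lambda>_. 1"]) auto
next
  case (Suc k)
  show ?case
  proof (cases "\<forall>j\<in>J. a k j = 0")
    case True
    obtain u where "\<exists>j\<in>J. u j \<noteq> 0" "\<forall>i<k. (\<Sum>j\<in>J. a i j * u j) = 0"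
      using Suc.IH[of J a] Suc.prems by auto
    with True show ?thesis by (intro exI[of _ u]) (auto simp: less_Suc_eq)
  next
    case False
    then obtain j0 where j0: "j0 \<in> J" "a k j0 \<noteq> 0" by blast
    define J' where "J' = J - {j0}"
    have J: "J = insert j0 J'" "j0 \<notin> J'" "finite J'" "k < card J'"
      using j0 Suc.prems by (auto simp: J'_def)
    obtain u where u: "\<exists>j\<in>J'. u j \<noteq> 0"
      "\<forall>i<k. (\<Sum>j\<in>J'. (a i j - a i j0 * a k j / a k j0) * u j) = 0"
      using Suc.IH[OF J(3,4), of "\<lambda>i j. a i j - a i j0 * a k j / a k j0"] by auto
    define s where "s = - (\<Sum>j\<in>J'. a k j * u j) / a k j0"
    have sum_eq: "(\<Sum>j\<in>J. a i j * (u(j0 := s)) j) = a i j0 * s + (\<Sum>j\<in>J'. a i j * u j)" for i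
      unfolding J(1) using J(2,3) by (auto intro!: sum.cong)
    have "(\<Sum>j\<in>J. a i j * (u(j0 := s)) j) = 0" if "i < Suc k" for i
    proof (cases "i = k")
      case False
      then have "0 = (\<Sum>j\<in>J'. (a i j - a i j0 * a k j / a k j0) * u j)"
        using u(2) that by simp
      also have "\<dots> = (\<Sum>j\<in>J'. a i j * u j) + a i j0 * s"
        unfolding s_def left_diff_distrib sum_subtractf
        by (simp add: sum_distrib_left sum_divide_distrib mult_ac)
      finally show ?thesis unfolding sum_eq by simp
    next
      case True
      have "a k j0 * s = - (\<Sum>j\<in>J'. a k j * u j)" using j0 by (simp add: s_def)
      then show ?thesis unfolding True sum_eq by simp
    qed
    moreover have "\<exists>j\<in>J. (u(j0 := s)) j \<noteq> 0"
      using u(1) J by auto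
    ultimately show ?thesis by blast
  qed
qed

text \<open>The weights move along a kernel direction \<open>u\<close> until the first one vanishes.
  Orienting \<open>u\<close> to have nonnegative sum keeps the mass from growing, so mass costs no
  equation: m + 1 moments always free one of m + 2 atoms.\<close>

lemma caratheodory_weights:
  fixes a :: "nat \<Rightarrow> 'j \<Rightarrow> real" and w :: "'j \<Rightarrow> real"
  assumes J: "finite J" "k < card J" and w: "\<forall>j\<in>J. 0 \<le> w j"
  shows "\<exists>w'. (\<forall>j\<in>J. 0 \<le> w' j) \<and> (\<exists>j\<in>J. w' j = 0) \<and> sum w' J \<le> sum w J \<and>
    (\<forall>i<k. (\<Sum>j\<in>J. a i j * w' j) = (\<Sum>j\<in>J. a i j * w j))"
proof -
  obtain u where u: "\<exists>j\<in>J. u j \<noteq> 0" "\<forall>i<k. (\<Sum>j\<in>J. a i j * u j) = 0" "sum u J \<ge> 0"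
  proof -
    obtain u where u: "\<exists>j\<in>J. u j \<noteq> 0" "\<forall>i<k. (\<Sum>j\<in>J. a i j * u j) = 0"
      using homogeneous_system_nontrivial[OF J] by blast
    show ?thesis
    proof (cases "sum u J \<ge> 0")
      case False
      then show ?thesis
        using u by (intro that[of "\<lambda>j. - u j"]) (auto simp: sum_negf)
    qed (use u that in blast)
  qed
  define P where "P = {j\<in>J. u j > 0}"
  have "P \<noteq> {}"
  proof
    assume "P = {}"
    then have "\<forall>j\<in>J. - u j \<ge> 0" by (auto simp: P_def not_less)
    moreover from this have "(\<Sum>j\<in>J. - u j) = 0"
      using u(3) sum_nonneg[of J "\<lambda>j. - u j"] by (simp add: sum_negf)
    ultimately show False
      using u(1) J(1) by (subst (asm) sum_nonneg_eq_0_iff) auto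
  qed
  moreover have fP: "finite P" using J by (simp add: P_def)
  ultimately have "Min ((\<lambda>j. w j / u j) ` P) \<in> (\<lambda>j. w j / u j) ` P"
    by (intro Min_in) auto
  then obtain j0 where j0: "j0 \<in> P" "Min ((\<lambda>j. w j / u j) ` P) = w j0 / u j0" by blast
  define \<tau> where "\<tau> = w j0 / u j0"
  have \<tau>: "\<tau> \<ge> 0" using j0 w by (auto simp: \<tau>_def P_def)
  have \<tau>_le: "\<tau> \<le> w j / u j" if "j \<in> P" for j
    using that fP j0(2) Min_le[of "(\<lambda>j. w j / u j) ` P" "w j / u j"] by (simp add: \<tau>_def)
  have "0 \<le> w j - \<tau> * u j" if j: "j \<in> J" for j
  proof (cases "j \<in> P")
    case True
    then show ?thesis using \<tau>_le[OF True] by (simp add: P_def field_simps)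
  next
    case False
    then have "\<tau> * u j \<le> 0" using j \<tau> by (intro mult_nonneg_nonpos) (auto simp: P_def)
    then show ?thesis using w j by fastforce
  qed
  moreover have "w j0 - \<tau> * u j0 = 0" "j0 \<in> J" using j0 by (auto simp: \<tau>_def P_def)
  moreover have "(\<Sum>j\<in>J. w j - \<tau> * u j) \<le> sum w J"
    using \<tau> u(3) by (simp add: sum_subtractf sum_distrib_left[symmetric])
  moreover have "(\<Sum>j\<in>J. a i j * (w j - \<tau> * u j)) = (\<Sum>j\<in>J. a i j * w j)" if "i < k" for i
  proof -
    have "(\<Sum>j\<in>J. a i j * (w j - \<tau> * u j)) = (\<Sum>j\<in>J. a i j * w j) - \<tau> * (\<Sum>j\<in>J. a i j * u j)"
      by (simp add: right_diff_distrib sum_subtractf sum_distrib_left mult_ac)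
    then show ?thesis using u(2) that by simp
  qed
  ultimately show ?thesis
    by (intro exI[of _ "\<lambda>j. w j - \<tau> * u j"]) blast
qed

section \<open>A theorem of the alternative for moments\<close>

text \<open>First order condition at the start of a segment: divide by l and let l tend to
  0.\<close>

lemma nonneg_slope:
  fixes S A :: real
  assumes "\<And>l. 0 < l \<Longrightarrow> l \<le> 1 \<Longrightarrow> 0 \<le> 2 * l * S + l\<^sup>2 * A" and A: "A \<ge> 0"
  shows "S \<ge> 0"
proof (rule ccontr)
  assume S: "\<not> S \<ge> 0"
  \<comment> \<open>This cap gives l A \<le> -S, hence 2 S + l A \<le> S < 0.\<close>
  define l where "l = min 1 (- S / (A + 1))"
  have l: "0 < l" "l \<le> 1" using S A by (auto simp: l_def divide_neg_pos)
  have "l * A \<le> - S / (A + 1) * A" using A by (intro mult_right_mono) (auto simp: l_def)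
  also have "\<dots> \<le> - S" using S A by (simp add: field_simps)
  finally have "2 * S + l * A < 0" using S by linarith
  then have "l * (2 * S + l * A) < 0" using l(1) by (simp add: mult_pos_neg)
  then show False using assms(1)[OF l] by (simp add: power2_eq_square algebra_simps)
qed

text \<open>Tychonoff's theorem. Every coordinate is confined, including those that carry no
  atom.\<close>

lemma compact_sequences:
  fixes S :: "'a::topological_space set"
  assumes "compact S"
  shows "compact {p :: nat \<Rightarrow> 'a. \<forall>j. p j \<in> S}"
proof -
  have "compactin (product_topology (\<lambda>_. euclidean) (UNIV::nat set)) (Pi\<^sub>E UNIV (\<lambda>_. S))"
    using assms by (simp add: compactin_PiE)
  then show ?thesis
    by (simp add: euclidean_product_topology PiE_UNIV_domain Pi_def)
qed

text \<open>The squared violation is minimised over measures with at most m + 1 of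
  the m + 2 possible atoms; by Caratheodory, moving towards a point mass stays within this
  compact set, so the minimiser satisfies a first order condition in every such direction.\<close>

lemma moment_alternative:
  fixes X :: "'a::topological_space set" and g :: "nat \<Rightarrow> 'a \<Rightarrow> real"
  assumes X: "compact X" "X \<noteq> {}" and g: "\<And>i. continuous_on X (g i)"
  obtains (solution) w x where "\<And>j. 0 \<le> w j" "\<And>j. x j \<in> X" "(\<Sum>j\<le>Suc m. w j) \<le> 1"
      "\<And>i. i \<in> {1..m} \<Longrightarrow> (\<Sum>j\<le>Suc m. w j * g i (x j)) = b i"
      "(\<Sum>j\<le>Suc m. w j * g 0 (x j)) \<le> v"
  | (certificate) c c0 \<delta> where "0 < \<delta>" "0 \<le> c0"
      "\<And>x. x \<in> X \<Longrightarrow> \<delta> \<le> (\<Sum>i\<in>{1..m}. c i * (g i x - b i)) + c0 * (g 0 x - v)"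
      "\<delta> \<le> (\<Sum>i\<in>{1..m}. c i * (- b i)) + c0 * (- v)"
proof -
  define J where "J = {..Suc m}"
  define G where "G = (\<lambda>i (p :: nat \<Rightarrow> real \<times> 'a). \<Sum>j\<in>J. fst (p j) * g i (snd (p j)))"
  \<comment> \<open>The last condition leaves a slot \<open>j0\<close> of weight zero, ready to
    receive a new atom.\<close>
  define K where "K = {p :: nat \<Rightarrow> real \<times> 'a. \<forall>j. p j \<in> {0..1} \<times> X} \<inter> {p. (\<Sum>j\<in>J. fst (p j)) \<le> 1}
    \<inter> (\<Union>j0\<in>J. {p. fst (p j0) = 0})"
  \<comment> \<open>Only an excess of the objective over \<open>v\<close> is penalised; this makes
    the multiplier \<open>c0\<close> nonnegative.\<close>
  define h where "h = (\<lambda>p. (\<Sum>i\<in>{1..m}. (G i p - b i)\<^sup>2) + (max 0 (G 0 p - v))\<^sup>2)"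
  obtain x0 where x0: "x0 \<in> X" using X by blast
  have finJ: "finite J" by (simp add: J_def)
  have "compact K"
    unfolding K_def Int_assoc
  proof (rule compact_Int_closed)
    show "compact {p :: nat \<Rightarrow> real \<times> 'a. \<forall>j. p j \<in> {0..1} \<times> X}"
      by (intro compact_sequences compact_Times X) auto
    have "closed (\<Union>j0\<in>J. {p :: nat \<Rightarrow> real \<times> 'a. fst (p j0) = 0})"
      using finJ by (intro closed_UN ballI closed_Collect_eq continuous_intros) auto
    moreover have "closed {p :: nat \<Rightarrow> real \<times> 'a. (\<Sum>j\<in>J. fst (p j)) \<le> 1}"
      by (intro closed_Collect_le continuous_intros) auto
    ultimately show "closed ({p :: nat \<Rightarrow> real \<times> 'a. (\<Sum>j\<in>J. fst (p j)) \<le> 1} \<inter> (\<Union>j0\<in>J. {p. fst (p j0) = 0}))"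
      by blast
  qed
  moreover have "K \<noteq> {}"
  proof -
    have "(\<lambda>_. (0, x0)) \<in> K" using x0 by (auto simp: K_def J_def)
    then show ?thesis by blast
  qed
  moreover have "continuous_on K h"
  proof -
    have coord: "continuous_on K (\<lambda>p. p j)" for j
      by (rule continuous_on_subset[OF continuous_on_product_coordinates]) simp
    then have "continuous_on K (\<lambda>p. snd (p j))" for j
      by (rule continuous_on_snd)
    then have "continuous_on K (\<lambda>p. g i (snd (p j)))" for i j
      by (rule continuous_on_compose2[OF g]) (auto simp: K_def mem_Times_iff)
    then show ?thesis
      unfolding h_def G_def using coord by (intro continuous_intros) auto
  qed
  ultimately have "\<exists>p\<in>K. \<forall>q\<in>K. h p \<le> h q"
    by (rule continuous_attains_inf)
  then obtain p where p: "p \<in> K" and min: "\<And>q. q \<in> K \<Longrightarrow> h p \<le> h q"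
    by blast
  define c where "c = (\<lambda>i. G i p - b i)"
  define c0 where "c0 = max 0 (G 0 p - v)"
  have hp: "h p = (\<Sum>i\<in>{1..m}. (c i)\<^sup>2) + c0\<^sup>2"
    by (simp add: h_def c_def c0_def)
  have first_order: "h p \<le> (\<Sum>i\<in>{1..m}. c i * (\<gamma> i - b i)) + c0 * (\<gamma> 0 - v)"
    if \<gamma>: "\<And>l. 0 < l \<Longrightarrow> l \<le> 1 \<Longrightarrow> \<exists>q\<in>K. \<forall>i\<le>m. G i q = (1 - l) * G i p + l * \<gamma> i" for \<gamma>
  proof -
    define a where "a = (\<lambda>i. \<gamma> i - G i p)"
    define S where "S = (\<Sum>i\<in>{1..m}. c i * a i) + c0 * a 0"
    define A where "A = (\<Sum>i\<in>{1..m}. (a i)\<^sup>2) + (a 0)\<^sup>2"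
    have "0 \<le> 2 * l * S + l\<^sup>2 * A" if l: "0 < l" "l \<le> 1" for l
    proof -
      obtain q where q: "q \<in> K" "\<forall>i\<le>m. G i q = (1 - l) * G i p + l * \<gamma> i"
        using \<gamma>[OF l] by blast
      have Gq: "G i q = G i p + l * a i" if "i \<le> m" for i
        using q(2) that by (simp add: a_def algebra_simps)
      \<comment> \<open>The positive part is not quadratic in l, but it is dominated by a quadratic
        with the same value at l = 0.\<close>
      have "(max 0 (G 0 q - v))\<^sup>2 \<le> (c0 + l * a 0)\<^sup>2"
      proof (cases "G 0 p - v \<ge> 0")
        case True
        then show ?thesis using Gq[of 0] by (simp add: c0_def max_def algebra_simps)
      next
        case False
        then have "\<bar>max 0 (G 0 q - v)\<bar> \<le> \<bar>c0 + l * a 0\<bar>"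
          using Gq[of 0] by (auto simp: c0_def max_def)
        then show ?thesis by (simp only: abs_le_square_iff)
      qed
      moreover have "(\<Sum>i\<in>{1..m}. (G i q - b i)\<^sup>2) = (\<Sum>i\<in>{1..m}. (c i + l * a i)\<^sup>2)"
        by (intro sum.cong refl) (auto simp: c_def Gq algebra_simps)
      ultimately have "h p \<le> (\<Sum>i\<in>{1..m}. (c i + l * a i)\<^sup>2) + (c0 + l * a 0)\<^sup>2"
        using min[OF q(1)] unfolding h_def by linarith
      also have "\<dots> = h p + 2 * l * S + l\<^sup>2 * A"
        unfolding hp S_def A_def power2_sum
        by (simp add: sum.distrib sum_distrib_left power_mult_distrib algebra_simps)
      finally show ?thesis by simp
    qed
    then have "S \<ge> 0"
      by (rule nonneg_slope) (auto simp: A_def intro!: add_nonneg_nonneg sum_nonneg)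
    moreover have "c0 * (\<gamma> 0 - v) = c0 * a 0 + c0\<^sup>2"
      by (auto simp: a_def c0_def max_def power2_eq_square algebra_simps)
    moreover have "(\<Sum>i\<in>{1..m}. c i * (\<gamma> i - b i)) = (\<Sum>i\<in>{1..m}. c i * a i) + (\<Sum>i\<in>{1..m}. (c i)\<^sup>2)"
      by (simp add: a_def c_def power2_eq_square algebra_simps flip: sum.distrib)
    ultimately show ?thesis unfolding hp S_def by linarith
  qed
  have pX: "snd (p j) \<in> X" and pw: "fst (p j) \<ge> 0" and pw1: "fst (p j) \<le> 1" for j
    using p by (auto simp: K_def mem_Times_iff)
  have p1: "(\<Sum>j\<in>J. fst (p j)) \<le> 1" using p by (simp add: K_def)
  obtain j0 where j0: "j0 \<in> J" "fst (p j0) = 0" using p by (auto simp: K_def)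
  \<comment> \<open>Shrinking towards the zero measure is possible since the mass is only bounded
    above; the resulting inequality later secures t' \<ge> 0.\<close>
  have zero: "h p \<le> (\<Sum>i\<in>{1..m}. c i * (0 - b i)) + c0 * (0 - v)"
  proof (rule first_order)
    fix l :: real assume l: "0 < l" "l \<le> 1"
    let ?q = "\<lambda>j. ((1 - l) * fst (p j), snd (p j))"
    have "(\<Sum>j\<in>J. (1 - l) * fst (p j)) \<le> 1"
      unfolding sum_distrib_left[symmetric] using l p1
      by (intro mult_le_one sum_nonneg pw) auto
    then have "?q \<in> K"
      using l pX pw pw1 j0 by (auto simp: K_def intro!: mult_le_one)
    then show "\<exists>q\<in>K. \<forall>i\<le>m. G i q = (1 - l) * G i p + l * 0"
      by (intro bexI[of _ ?q]) (auto simp: G_def sum_distrib_left mult_ac)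
  qed
  have point: "h p \<le> (\<Sum>i\<in>{1..m}. c i * (g i x - b i)) + c0 * (g 0 x - v)" if x: "x \<in> X" for x
  proof (rule first_order)
    fix l :: real assume l: "0 < l" "l \<le> 1"
    \<comment> \<open>The mass l at x fills the empty slot, so all m + 2 slots may be in use;
      \<open>caratheodory_weights\<close> empties one again without changing the m + 1
      moments.\<close>
    define w where "w = (\<lambda>j. (1 - l) * fst (p j) + (if j = j0 then l else 0))"
    define z where "z = (\<lambda>j. if j = j0 then x else snd (p j))"
    have "\<forall>j\<in>J. 0 \<le> w j" using l pw by (auto simp: w_def)
    moreover have "Suc m < card J" by (simp add: J_def)
    ultimately obtain w' where w': "\<forall>j\<in>J. 0 \<le> w' j" "\<exists>j\<in>J. w' j = 0" "sum w' J \<le> sum w J"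
      "\<forall>i<Suc m. (\<Sum>j\<in>J. g i (z j) * w' j) = (\<Sum>j\<in>J. g i (z j) * w j)"
      using caratheodory_weights[OF finJ, of "Suc m" w "\<lambda>i j. g i (z j)"] by blast
    have "sum w J = (1 - l) * (\<Sum>j\<in>J. fst (p j)) + l"
      using j0 finJ by (simp add: w_def sum.distrib sum_distrib_left)
    also have "\<dots> \<le> (1 - l) * 1 + l" using p1 l by (intro add_mono mult_left_mono) auto
    finally have w'1: "sum w' J \<le> 1" using w'(3) by simp
    have w'le: "w' j \<le> 1" if "j \<in> J" for j
      using member_le_sum[of j J w'] that w'(1) finJ w'1 by fastforce
    \<comment> \<open>Nothing is known of \<open>w'\<close> outside \<open>J\<close>, while
      \<open>K\<close> restricts all coordinates.\<close>
    define q where "q = (\<lambda>j. (if j \<in> J then w' j else 0, z j))"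
    have "q \<in> K"
      using w' w'1 w'le x pX by (auto simp: K_def q_def z_def)
    moreover have "G i q = (1 - l) * G i p + l * g i x" if "i \<le> m" for i
    proof -
      have "G i q = (\<Sum>j\<in>J. g i (z j) * w' j)"
        by (simp add: G_def q_def mult_ac)
      also have "\<dots> = (\<Sum>j\<in>J. g i (z j) * w j)" using w'(4) that by auto
      also have "\<dots> = (\<Sum>j\<in>J. (1 - l) * (fst (p j) * g i (snd (p j))) + (if j = j0 then l * g i x else 0))"
        using j0 by (intro sum.cong refl) (auto simp: w_def z_def)
      also have "\<dots> = (1 - l) * G i p + l * g i x"
        using j0 finJ by (simp add: sum.distrib sum_distrib_left G_def)
      finally show ?thesis .
    qed
    ultimately show "\<exists>q\<in>K. \<forall>i\<le>m. G i q = (1 - l) * G i p + l * g i x" by blast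
  qed
  show ?thesis
  proof (cases "h p = 0")
    case True
    then have "(\<Sum>i\<in>{1..m}. (c i)\<^sup>2) = 0" "c0 = 0"
      unfolding hp by (simp_all add: add_nonneg_eq_0_iff sum_nonneg)
    then have "\<forall>i\<in>{1..m}. c i = 0" by (simp add: sum_nonneg_eq_0_iff)
    then show ?thesis
      using pX pw p1 \<open>c0 = 0\<close>
      by (intro solution[of "\<lambda>j. fst (p j)" "\<lambda>j. snd (p j)"])
        (auto simp: c_def c0_def G_def J_def max_def split: if_splits)
  next
    case False
    then have "h p > 0"
      unfolding hp by (simp add: less_le sum_nonneg)
    then show ?thesis
      using zero point by (intro certificate[of "h p" c0 c]) (auto simp: c0_def)
  qed
qed

section \<open>Measures on the simplex and their moments\<close>

lemma continuous_on_monom_eval [continuous_intros]: "continuous_on S (monom_eval \<alpha>)"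
  unfolding monom_eval_def by (intro continuous_intros)

lemma continuous_on_heval [continuous_intros]: "continuous_on S (heval e f)"
  unfolding heval_def by (intro continuous_intros)

lemma compact_std_simplex: "compact (std_simplex :: (real^'n::finite) set)"
proof -
  have "std_simplex = (\<Inter>i. {x::real^'n. 0 \<le> x $ i}) \<inter> {x. (\<Sum>i\<in>UNIV. x $ i) = 1}"
    by (auto simp: std_simplex_def)
  moreover have "closed \<dots>"
    by (intro closed_Int closed_INT ballI closed_Collect_le closed_Collect_eq continuous_intros)
  moreover have "norm x \<le> 1" if "x \<in> std_simplex" for x :: "real^'n"
    using norm_le_l1_cart[of x] that by (simp add: std_simplex_def)
  then have "bounded (std_simplex :: (real^'n) set)" by (auto simp: bounded_iff)
  ultimately show ?thesis by (simp add: compact_eq_bounded_closed)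
qed

lemma set_integrable_simplex:
  fixes \<mu> :: "(real^'n::finite) measure"
  assumes sets: "sets \<mu> = sets borel" and fin: "finite_measure \<mu>" and g: "continuous_on UNIV g"
  shows "set_integrable \<mu> std_simplex (g :: _ \<Rightarrow> real)"
proof -
  interpret finite_measure \<mu> by (rule fin)
  have "compact (g ` (std_simplex :: (real^'n) set))"
    by (intro compact_continuous_image continuous_on_subset[OF g] compact_std_simplex) auto
  then obtain B where B: "\<And>x. x \<in> std_simplex \<Longrightarrow> norm (g x) \<le> B"
    using compact_imp_bounded bounded_iff by (metis imageI)
  have [measurable]: "g \<in> borel_measurable \<mu>"
    using g sets by (metis borel_measurable_continuous_onI measurable_cong_sets)
  have [measurable]: "std_simplex \<in> sets \<mu>"
    unfolding sets by (rule borel_compact[OF compact_std_simplex])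
  show ?thesis
    unfolding set_integrable_def
    by (rule integrable_const_bound[of _ "\<bar>B\<bar>"])
      (auto intro!: AE_I2 simp: indicator_def dest!: B)
qed

lemma set_integral_heval:
  fixes \<mu> :: "(real^'n::finite) measure"
  assumes sets: "sets \<mu> = sets borel" and fin: "finite_measure \<mu>"
  shows "Lapply e (\<lambda>\<alpha>. LINT x:std_simplex|\<mu>. monom_eval \<alpha> x) f = (LINT x:std_simplex|\<mu>. heval e f x)"
proof -
  have "integrable \<mu> (\<lambda>x. f \<alpha> * (indicator std_simplex x *\<^sub>R monom_eval \<alpha> x))" for \<alpha>
    using set_integrable_simplex[OF sets fin continuous_on_monom_eval[of UNIV \<alpha>]]
    by (simp add: set_integrable_def)
  then show ?thesis
    unfolding Lapply_def set_lebesgue_integral_def heval_def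
    by (simp add: sum_distrib_left mult.left_commute flip: integral_sum)
qed

lemma set_integral_simplex_const:
  fixes \<mu> :: "(real^'n::finite) measure"
  assumes sets: "sets \<mu> = sets borel"
  shows "(LINT x:std_simplex|\<mu>. c) = c * measure \<mu> std_simplex"
  using sets_eq_imp_space_eq[OF sets] by (simp add: set_lebesgue_integral_def)

text \<open>Consistency holds because x1 + ... + xn = 1 where the integrals are taken.\<close>

lemma gmp_feasible_moments:
  fixes f :: "nat \<Rightarrow> ('n::finite \<Rightarrow> nat) \<Rightarrow> real"
  assumes "gmp_feasible d m f b \<mu>"
  shows "lp_feasible d m f b r (\<lambda>\<alpha>. LINT x:std_simplex|\<mu>. monom_eval \<alpha> x)" (is "lp_feasible _ _ _ _ _ ?L")
proof -
  have sets: "sets \<mu> = sets borel" and fin: "finite_measure \<mu>"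
    and b: "\<forall>i\<in>{1..m}. (LINT x:std_simplex|\<mu>. heval d (f i) x) = b i" and mass: "measure \<mu> std_simplex \<le> 1"
    using assms by (auto simp: gmp_feasible_def)
  have "?L \<alpha> = (\<Sum>j\<in>UNIV. ?L (inc j \<alpha>))" for \<alpha> :: "'n \<Rightarrow> nat"
  proof -
    have inc: "monom_eval (inc j \<alpha>) x = x $ j * monom_eval \<alpha> x" for j and x :: "real^'n"
      unfolding monom_eval_def by (subst prod_inc, subst prod_split_coordinate[of _ _ j]) simp
    have split: "indicator std_simplex x *\<^sub>R monom_eval \<alpha> x
        = (\<Sum>j\<in>UNIV. indicator std_simplex x *\<^sub>R monom_eval (inc j \<alpha>) x)" for x
      by (simp add: inc indicator_def std_simplex_def flip: sum_distrib_right)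
    have "integrable \<mu> (\<lambda>x. indicator std_simplex x *\<^sub>R monom_eval (inc j \<alpha>) x)" for j
      using set_integrable_simplex[OF sets fin continuous_on_monom_eval[of UNIV "inc j \<alpha>"]]
      by (simp add: set_integrable_def)
    then show ?thesis
      unfolding set_lebesgue_integral_def split by (rule Bochner_Integration.integral_sum)
  qed
  moreover have "0 \<le> ?L \<alpha>" for \<alpha> :: "'n \<Rightarrow> nat"
    unfolding set_lebesgue_integral_def
    by (intro integral_nonneg_AE AE_I2) (auto simp: indicator_def monom_eval_nonneg)
  moreover have "?L (\<lambda>_. 0) \<le> 1"
    using mass set_integral_simplex_const[OF sets, of 1] by (simp add: monom_eval_def)
  moreover have "\<forall>i\<in>{1..m}. Lapply d ?L (f i) = b i"
    using b by (simp add: set_integral_heval[OF sets fin])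
  ultimately show ?thesis
    unfolding lp_feasible_def inc_def by blast
qed

text \<open>The measure is the image under \<open>x\<close> of a weighted measure on the indices, so
  coinciding atoms add their weights.\<close>

lemma atomic_measure_feasible:
  fixes f :: "nat \<Rightarrow> ('n::finite \<Rightarrow> nat) \<Rightarrow> real"
  assumes J: "finite J" and w: "\<And>j. j \<in> J \<Longrightarrow> 0 \<le> w j" and x: "\<And>j. x j \<in> std_simplex"
    and mass: "sum w J \<le> 1"
    and b: "\<And>i. i \<in> {1..m} \<Longrightarrow> (\<Sum>j\<in>J. w j * heval d (f i) (x j)) = b i"
  obtains \<mu> where "gmp_feasible d m f b \<mu>"
    "(LINT x:std_simplex|\<mu>. heval d (f 0) x) = (\<Sum>j\<in>J. w j * heval d (f 0) (x j))"
proof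
  define P where "P = point_measure J (\<lambda>j. ennreal (w j))"
  define \<mu> where "\<mu> = distr P borel x"
  have [measurable]: "x \<in> measurable P borel"
    by (simp add: P_def)
  have [measurable]: "std_simplex \<in> sets borel"
    using compact_std_simplex by (rule borel_compact)
  have sets: "sets \<mu> = sets borel" by (simp add: \<mu>_def)
  have fin: "finite_measure \<mu>"
    unfolding \<mu>_def
    by (intro finite_measure.finite_measure_distr finite_measureI)
      (simp_all add: P_def space_point_measure emeasure_point_measure_finite J)
  have int: "(LINT y:std_simplex|\<mu>. g y) = (\<Sum>j\<in>J. w j * g (x j))"
    if [measurable]: "g \<in> borel_measurable borel" for g :: "real^'n \<Rightarrow> real"
    unfolding set_lebesgue_integral_def \<mu>_def
    by (subst integral_distr) (simp_all add: P_def lebesgue_integral_point_measure_finite J w x)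
  have heval: "(LINT y:std_simplex|\<mu>. heval d h y) = (\<Sum>j\<in>J. w j * heval d h (x j))" for h
    by (intro int borel_measurable_continuous_onI continuous_on_heval)
  have "x -` (UNIV - std_simplex) = {}" using x by auto
  then have "emeasure \<mu> (UNIV - std_simplex) = 0"
    unfolding \<mu>_def by (subst emeasure_distr) auto
  moreover have "measure \<mu> std_simplex \<le> 1"
    using int[of "\<lambda>_. 1"] set_integral_simplex_const[OF sets, of 1] mass by simp
  ultimately show "gmp_feasible d m f b \<mu>"
    unfolding gmp_feasible_def using sets fin heval b by simp
  show "(LINT x:std_simplex|\<mu>. heval d (f 0) x) = (\<Sum>j\<in>J. w j * heval d (f 0) (x j))"
    by (rule heval)
qed

section \<open>No duality gap\<close>

lemma gmp_solution_attains_dual: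
  fixes f :: "nat \<Rightarrow> ('n::finite \<Rightarrow> nat) \<Rightarrow> real"
  assumes feas: "gmp_feasible d m f b \<nu>" and opt: "dual_optimal d m f b y t"
  obtains \<mu> where "gmp_feasible d m f b \<mu>"
    "(LINT x:std_simplex|\<mu>. heval d (f 0) x) \<le> (\<Sum>i\<in>{1..m}. y i * b i) - t"
proof -
  define v where "v = (\<Sum>i\<in>{1..m}. y i * b i) - t"
  have ne: "(std_simplex :: (real^'n) set) \<noteq> {}" using std_simplex_axis by blast
  show ?thesis
  proof (rule moment_alternative[where g = "\<lambda>i. heval d (f i)" and m = m and b = b and v = v,
        OF compact_std_simplex ne continuous_on_heval])
    fix w :: "nat \<Rightarrow> real" and x :: "nat \<Rightarrow> real^'n"
    assume *: "\<And>j. 0 \<le> w j" "\<And>j. x j \<in> std_simplex" "(\<Sum>j\<le>Suc m. w j) \<le> 1"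
      "\<And>i. i \<in> {1..m} \<Longrightarrow> (\<Sum>j\<le>Suc m. w j * heval d (f i) (x j)) = b i"
      "(\<Sum>j\<le>Suc m. w j * heval d (f 0) (x j)) \<le> v"
    show ?thesis
    proof (rule atomic_measure_feasible[of "{..Suc m}" w x m d f b])
      fix \<mu> assume "gmp_feasible d m f b \<mu>"
        "(LINT x:std_simplex|\<mu>. heval d (f 0) x) = (\<Sum>j\<le>Suc m. w j * heval d (f 0) (x j))"
      then show ?thesis using *(5) that unfolding v_def by simp
    qed (use * in auto)
  next
    fix c and c0 \<delta> :: real
    assume \<delta>: "0 < \<delta>" and c0: "0 \<le> c0"
      and point: "\<And>x :: real^'n. x \<in> std_simplex \<Longrightarrow>
        \<delta> \<le> (\<Sum>i\<in>{1..m}. c i * (heval d (f i) x - b i)) + c0 * (heval d (f 0) x - v)"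
      and zero: "\<delta> \<le> (\<Sum>i\<in>{1..m}. c i * (- b i)) + c0 * (- v)"
    have False
    proof (cases "c0 = 0")
      case True
      \<comment> \<open>Integrating over \<nu> gives (\<delta> + s) times the mass \<le> s. As
        \<delta> + s \<le> 0 and the mass is at most 1, this forces \<delta> \<le> 0.\<close>
      define s where "s = (\<Sum>i\<in>{1..m}. c i * b i)"
      have s: "\<delta> + s \<le> 0" using zero True by (simp add: s_def sum_negf)
      have sets: "sets \<nu> = sets borel" and fin: "finite_measure \<nu>"
        and b: "\<And>i. i\<in>{1..m} \<Longrightarrow> (LINT x:std_simplex|\<nu>. heval d (f i) x) = b i"
        and mass: "measure \<nu> std_simplex \<le> 1"
        using feas by (auto simp: gmp_feasible_def)
      have int: "integrable \<nu> (\<lambda>x. indicator std_simplex x *\<^sub>R heval d (f i) x)" for i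
        using set_integrable_simplex[OF sets fin continuous_on_heval] by (simp add: set_integrable_def)
      have "(LINT x:std_simplex|\<nu>. \<delta> + s) \<le> (LINT x:std_simplex|\<nu>. \<Sum>i\<in>{1..m}. c i * heval d (f i) x)"
        using point True
        by (intro set_integral_mono set_integrable_simplex sets fin continuous_intros)
          (force simp: right_diff_distrib sum_subtractf s_def)
      also have "\<dots> = (\<Sum>i\<in>{1..m}. c i * (LINT x:std_simplex|\<nu>. heval d (f i) x))"
      proof -
        have "(\<lambda>x. indicator std_simplex x *\<^sub>R (\<Sum>i\<in>{1..m}. c i * heval d (f i) x))
          = (\<lambda>x. \<Sum>i\<in>{1..m}. c i * (indicator std_simplex x *\<^sub>R heval d (f i) x))"
          by (simp add: sum_distrib_left mult.left_commute)
        then show ?thesis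
          unfolding set_lebesgue_integral_def using int by simp
      qed
      also have "\<dots> = s" unfolding s_def using b by simp
      finally have "(\<delta> + s) * measure \<nu> std_simplex \<le> s"
        by (simp only: set_integral_simplex_const[OF sets])
      moreover have "(\<delta> + s) * measure \<nu> std_simplex \<ge> (\<delta> + s) * 1"
        using s mass by (intro mult_left_mono_neg) auto
      ultimately show False using \<delta> by simp
    next
      case False
      then have pos: "c0 > 0" using c0 by simp
      define y' where "y' = (\<lambda>i. - c i / c0)"
      \<comment> \<open>Chosen so that the dual value is v + \<delta>/c0, beyond the optimum. The
        inequality \<open>zero\<close> gives t' \<ge> 0, and \<open>point\<close> the nonnegative
        slack.\<close>
      define t' where "t' = (\<Sum>i\<in>{1..m}. y' i * b i) - v - \<delta> / c0"
      have scale: "(\<Sum>i\<in>{1..m}. c i * h i) = - c0 * (\<Sum>i\<in>{1..m}. y' i * h i)" for h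
        using pos by (simp add: y'_def sum_distrib_left)
      have "dual_feasible d m f y' t'"
        unfolding dual_feasible_def
      proof (intro conjI ballI)
        have "\<delta> \<le> c0 * ((\<Sum>i\<in>{1..m}. y' i * b i) - v)"
          using zero unfolding scale by (simp add: sum_negf algebra_simps)
        then show "0 \<le> t'" using pos by (simp add: t'_def field_simps)
      next
        fix x :: "real^'n" assume "x \<in> std_simplex"
        from point[OF this] have "\<delta> \<le> c0 * (heval d (f 0) x - (\<Sum>i\<in>{1..m}. y' i * heval d (f i) x)
            + (\<Sum>i\<in>{1..m}. y' i * b i) - v)"
          unfolding scale by (simp add: right_diff_distrib sum_subtractf algebra_simps)
        then have "\<delta> / c0 \<le> heval d (f 0) x - (\<Sum>i\<in>{1..m}. y' i * heval d (f i) x)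
            + (\<Sum>i\<in>{1..m}. y' i * b i) - v"
          using pos by (simp add: pos_divide_le_eq mult.commute)
        then show "0 \<le> heval d (f 0) x - (\<Sum>i\<in>{1..m}. y' i * heval d (f i) x) + t'"
          by (simp add: t'_def)
      qed
      then have "(\<Sum>i\<in>{1..m}. y' i * b i) - t' \<le> v"
        using opt by (simp add: dual_optimal_def v_def)
      moreover have "\<delta> / c0 > 0" using \<delta> pos by simp
      ultimately show False by (simp add: t'_def)
    qed
    then show ?thesis ..
  qed
qed

section \<open>Assembling the bound\<close>

text \<open>All normalised coefficients of t (x1 + ... + xn)^d equal t, and a maximum of sums is at
  most the sum of the maxima.\<close>

lemma Bnum_lagrangian_le:
  fixes f :: "nat \<Rightarrow> ('n::finite \<Rightarrow> nat) \<Rightarrow> real"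
  shows "Bnum d (\<lambda>\<alpha>. (\<Sum>i\<in>I. y i * f i \<alpha>) + t * (fact d / mfact \<alpha>)) \<le> (\<Sum>i\<in>I. Bnum d (\<lambda>\<alpha>. y i * f i \<alpha>)) + t"
proof -
  have ne: "(hmons d :: ('n \<Rightarrow> nat) set) \<noteq> {}"
  proof -
    have "(\<lambda>i::'n. if i = undefined then d else 0) \<in> hmons d" by (simp add: hmons_def)
    then show ?thesis by blast
  qed
  have "mfact \<alpha> / fact d * ((\<Sum>i\<in>I. y i * f i \<alpha>) + t * (fact d / mfact \<alpha>))
      \<le> (\<Sum>i\<in>I. Bnum d (\<lambda>\<alpha>. y i * f i \<alpha>)) + t" if "\<alpha> \<in> hmons d" for \<alpha>
  proof -
    have "(\<Sum>i\<in>I. mfact \<alpha> / fact d * (y i * f i \<alpha>)) \<le> (\<Sum>i\<in>I. Bnum d (\<lambda>\<alpha>. y i * f i \<alpha>))"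
      using that by (intro sum_mono Bnum_ge)
    then show ?thesis by (simp only: distrib_left sum_distrib_left) simp
  qed
  then show ?thesis
    unfolding Bnum_def[of d "\<lambda>\<alpha>. (\<Sum>i\<in>I. y i * f i \<alpha>) + t * (fact d / mfact \<alpha>)"] mfact_def[symmetric]
    using ne by (subst Max_le_iff) (auto simp: finite_hmons)
qed

theorem theorem5:
  fixes f :: "nat \<Rightarrow> ('n::finite \<Rightarrow> nat) \<Rightarrow> real"
    and b ybar :: "nat \<Rightarrow> real" and t :: real and d m r :: nat
  assumes homog: "\<forall>i\<le>m. is_homog d (f i)"
    and feas: "\<exists>\<mu>. gmp_feasible d m f b \<mu>"
    and opt: "dual_optimal d m f b ybar t"
    and r: "real r > real d * (real d - 1) / 2 + 1"
  shows "let y = (\<lambda>i. if i = 0 then 1 else - ybar i);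
             ybar_m1 = - t;
             y_m1 = - ybar_m1;
             f_m1 = (\<lambda>\<alpha>::'n \<Rightarrow> nat. if \<alpha> \<in> hmons 0 then (1::real) else 0)
         in 0 \<le> gmp_val d m f b - lp_val d m f b r \<and>
            gmp_val d m f b - lp_val d m f b r
              \<le> ((\<Sum>i\<in>{0..m}. Bnum d (\<lambda>\<alpha>. y i * f i \<alpha>)) + Bnum 0 (\<lambda>\<alpha>. y_m1 * f_m1 \<alpha>) + t)
                 * (real d * (real d - 1)) / (2 * (real r - 1) - real d * (real d - 1))"
proof -
  define y where "y = (\<lambda>i. if i = 0 then 1 else - ybar i)"
  define p where "p = (\<lambda>\<alpha>. (\<Sum>i\<in>{0..m}. y i * f i \<alpha>) + t * (fact d / mfact \<alpha>))"
  define v where "v = (\<Sum>i\<in>{1..m}. ybar i * b i) - t"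
  define E where "E = real d * (real d - 1) / (2 * (real r - 1) - real d * (real d - 1))"
  have split: "(\<Sum>i\<in>{0..m}. y i * h i) = h 0 - (\<Sum>i\<in>{1..m}. ybar i * h i)" for h :: "nat \<Rightarrow> real"
    by (subst sum.atLeast_Suc_atMost) (auto simp: y_def sum_negf intro!: sum.cong)
  have t: "t \<ge> 0" and dual: "\<And>x. x \<in> std_simplex \<Longrightarrow>
      0 \<le> heval d (f 0) x - (\<Sum>i\<in>{1..m}. ybar i * heval d (f i) x) + t"
    using opt by (auto simp: dual_optimal_def dual_feasible_def)
  \<comment> \<open>The weight \<open>h\<close> stays general: monomials give the value of
    \<open>p\<close> at a point, and \<open>L\<close> gives L(p).\<close>
  have Lp: "(\<Sum>\<alpha>\<in>hmons d. p \<alpha> * h \<alpha>)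
      = (\<Sum>\<alpha>\<in>hmons d. f 0 \<alpha> * h \<alpha>) - (\<Sum>i\<in>{1..m}. ybar i * (\<Sum>\<alpha>\<in>hmons d. f i \<alpha> * h \<alpha>)) + t * multi_sum d h" for h
  proof -
    have "(\<Sum>\<alpha>\<in>hmons d. p \<alpha> * h \<alpha>) = (\<Sum>\<alpha>\<in>hmons d. \<Sum>i\<in>{0..m}. y i * f i \<alpha> * h \<alpha>) + t * multi_sum d h"
      by (simp add: p_def multi_sum_def distrib_right sum.distrib sum_distrib_left sum_distrib_right mult.assoc)
    also have "(\<Sum>\<alpha>\<in>hmons d. \<Sum>i\<in>{0..m}. y i * f i \<alpha> * h \<alpha>) = (\<Sum>i\<in>{0..m}. y i * (\<Sum>\<alpha>\<in>hmons d. f i \<alpha> * h \<alpha>))"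
      by (subst sum.swap) (simp add: sum_distrib_left mult.assoc)
    finally show ?thesis unfolding split .
  qed
  have p_nonneg: "0 \<le> heval d p x" if "x \<in> std_simplex" for x
    using dual[OF that] that unfolding heval_def Lp multi_sum_monom by (simp add: std_simplex_def)
  have E: "E \<ge> 0"
  proof -
    have "real d * (real d - 1) \<ge> 0" by (cases d) auto
    then show ?thesis using r unfolding E_def by (intro divide_nonneg_nonneg) auto
  qed
  have lower: "v - Bnum d p * E \<le> Lapply d L (f 0)" if L: "lp_feasible d m f b r L" for L
  proof -
    have cons: "L \<alpha> = (\<Sum>j\<in>UNIV. L (inc j \<alpha>))" if "(\<Sum>i\<in>UNIV. \<alpha> i) \<le> r - 1" for \<alpha>
      using L that by (simp add: lp_feasible_def inc_def)
    have L1: "L (\<lambda>_. 0) \<le> 1" using L unfolding lp_feasible_def by blast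
    have "- (Bnum d p * E) \<le> Lapply d L p"
      unfolding E_def using L cons
      by (intro Lapply_lower_bound[OF r p_nonneg] L1 cons) (auto simp: lp_feasible_def)
    also have "Lapply d L p = Lapply d L (f 0) - (\<Sum>i\<in>{1..m}. ybar i * b i) + t * L (\<lambda>_. 0)"
    proof -
      have "multi_sum d L = L (\<lambda>_. 0)"
        using multi_sum_consistent[of r L "\<lambda>_. 0" d] cons degree_le_level[OF r] by simp
      moreover have "(\<Sum>\<alpha>\<in>hmons d. f i \<alpha> * L \<alpha>) = b i" if "i \<in> {1..m}" for i
        using L that by (simp add: lp_feasible_def Lapply_def)
      ultimately show ?thesis unfolding Lapply_def Lp by simp
    qed
    also have "\<dots> \<le> Lapply d L (f 0) - v"
      using mult_left_le[OF L1 t] by (simp add: v_def)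
    finally show ?thesis by simp
  qed
  let ?G = "(\<lambda>\<mu>. LINT x:std_simplex|\<mu>. heval d (f 0) x) ` {\<mu>. gmp_feasible d m f b \<mu>}"
  let ?P = "(\<lambda>L. Lapply d L (f 0)) ` {L. lp_feasible d m f b r L}"
  have sub: "?G \<subseteq> ?P"
  proof
    fix z assume "z \<in> ?G"
    then obtain \<mu> where \<mu>: "gmp_feasible d m f b \<mu>" "z = (LINT x:std_simplex|\<mu>. heval d (f 0) x)" by blast
    then have "z = Lapply d (\<lambda>\<alpha>. LINT x:std_simplex|\<mu>. monom_eval \<alpha> x) (f 0)"
      by (simp add: gmp_feasible_def set_integral_heval)
    then show "z \<in> ?P" using gmp_feasible_moments[OF \<mu>(1)] by blast
  qed
  \<comment> \<open>A real \<open>Inf\<close> is informative only for nonempty sets bounded below;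
    through \<open>sub\<close> this bound serves the moment problem as well.\<close>
  have bddP: "bdd_below ?P" using lower by (auto intro!: bdd_belowI)
  have G: "?G \<noteq> {}" using feas by blast
  have "lp_val d m f b r \<le> gmp_val d m f b"
    unfolding lp_val_def gmp_val_def by (rule cInf_superset_mono[OF G bddP sub])
  moreover have "v - Bnum d p * E \<le> lp_val d m f b r"
    unfolding lp_val_def using G sub lower by (intro cInf_greatest) auto
  moreover have "gmp_val d m f b \<le> v"
  proof -
    obtain \<nu> where "gmp_feasible d m f b \<nu>" using feas by blast
    then obtain \<mu> where \<mu>: "gmp_feasible d m f b \<mu>" "(LINT x:std_simplex|\<mu>. heval d (f 0) x) \<le> v"
      using gmp_solution_attains_dual[OF _ opt] unfolding v_def by blast
    have "gmp_val d m f b \<le> (LINT x:std_simplex|\<mu>. heval d (f 0) x)"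
      unfolding gmp_val_def using \<mu>(1) by (intro cInf_lower bdd_below_mono[OF bddP sub]) auto
    then show ?thesis using \<mu>(2) by simp
  qed
  \<comment> \<open>One t bounds the share of t (x1 + ... + xn)^d in B(p) and matches B(y_{m+1}
    f_{m+1}) in the claim; the other is the separate summand t, added since t \<ge> 0.\<close>
  moreover have "Bnum d p * E \<le> ((\<Sum>i\<in>{0..m}. Bnum d (\<lambda>\<alpha>. y i * f i \<alpha>)) + t + t) * E"
    using Bnum_lagrangian_le[of d y f "{0..m}" t] t E unfolding p_def by (intro mult_right_mono) auto
  moreover have "Bnum 0 (\<lambda>\<alpha>::'n \<Rightarrow> nat. t * (if \<alpha> \<in> hmons 0 then 1 else 0)) = t"
    by (simp add: Bnum_def hmons_0)
  ultimately show ?thesis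
    unfolding Let_def y_def[symmetric] by (simp add: E_def)
qed

end
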